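(* Let $q=2^r$ with $r\geq 3$, let $n=2^s$ with $s\in\mathbb{Z}_{>0}$, and put $N_1=(q-1)^{n-1}$. Then for every $h=1,2,\dots$, \[ MK_{n-1}^{h}=\sum_{l=0}^{h-1}(-1)^{h+l+1}\binom{h}{l}(q-1)^{(n-1)(h-l)}MK_{n-1}^{l} +q\sum_{j=0}^{\min\{(q-1)^{n-1},h\}}(-1)^{h+j}C_{n-1,j}\sum_{t=j}^{h}t!\,S(h,t)\,2^{h-t}\binom{(q-1)^{n-1}-j}{(q-1)^{n-1}-t}. \] Moreover, the weight distribution of $C_{n-1}$ is given by \[ C_{n-1,j}=\sum\prod_{\beta\in\mathbb{F}_q}\binom{\delta(n-1,q;\beta)}{\nu_\beta}, \] where the sum runs over all families of integers $\{\nu_\beta\}_{\beta\in\mathbb{F}_q}$ with $0\le\nu_\beta\le\delta(n-1,q;\beta)$, $\sum_{\beta\in\mathbb{F}_q}\nu_\beta=j$ and $\sum_{\beta\in\mathbb{F}_q}\nu_\beta\beta=0$ (the latter an identity in $\mathbb{F}_q$). Here \[ \delta(n-1,q;\beta)=|\{(\alpha_1,\dots,\alpha_{n-1})\in(\mathbb{F}_q^* )^{n-1}:\alpha_1+\cdots+\alpha_{n-1}+\alpha_1^{-1}\cdots\alpha_{n-1}^{-1}=\beta\}|, \] which equals $q^{-1}\{(q-1)^{n-1}+1\}$ if $\beta=0$ and $K_{n-2}(\lambda;\beta^{-1})+q^{-1}\{(q-1)^{n-1}+1\}$ if $\beta\in\mathbb{F}_q^*$.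
   Context: $\mathbb{F}_q$ is the finite field with $q=2^r$ elements, $tr:\mathbb{F}_q\to\mathbb{F}_2$, $tr(x)=x+x^2+\cdots+x^{2^{r-1}}$, and $\lambda(x)=(-1)^{tr(x)}$ is the canonical additive character. For $m\ge1$ and $a\in\mathbb{F}_q^*$, the $m$-dimensional Kloosterman sum is $K_m(\lambda;a)=\sum_{\alpha_1,\dots,\alpha_m\in\mathbb{F}_q^*}\lambda(\alpha_1+\cdots+\alpha_m+a\alpha_1^{-1}\cdots\alpha_m^{-1})$; by convention $K_0(\lambda;a)=\lambda(a)$. For $h\ge0$, $MK_m^h=\sum_{a\in\mathbb{F}_q^*}K_m(\lambda;a)^h$. $S(h,t)=\frac{1}{t!}\sum_{j=0}^{t}(-1)^{t-j}\binom{t}{j}j^h$ is the Stirling number of the second kind. Fix an ordering of $(\mathbb{F}_q^* )^{n-1}$ and let $v_{n-1}=(g_1,\dots,g_{N_1})\in\mathbb{F}_q^{N_1}$, where $g_i=\alpha_1+\cdots+\alpha_{n-1}+\alpha_1^{-1}\cdots\alpha_{n-1}^{-1}$ for the $i$-th tuple $(\alpha_1,\dots,\alpha_{n-1})$. The binary linear code $C_{n-1}$ is $\{u\in\mathbb{F}_2^{N_1}:\sum_{i}u_ig_i=0 \text{ in } \mathbb{F}_q\}$, and $C_{n-1,j}$ denotes the number of codewords of Hamming weight $j$ in $C_{n-1}$. *)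

theory Defs
  imports
    "HOL-Computational_Algebra.Computational_Algebra"
    "HOL-Number_Theory.Residues"
    "HOL-Combinatorics.Stirling"
    "HOL-Library.Cardinality"
    "HOL-Library.Z2"
begin

section \<open>The canonical additive character\<close>

text \<open>The trace of a field with \<open>2 ^ r\<close> elements to its prime field. It is kept inside the big
  field, with the prime field being \<open>{0, 1}\<close>; see \<open>trace2_cases\<close> below.\<close>

definition trace2 :: "nat \<Rightarrow> 'a::finite_field \<Rightarrow> 'a"
  where "trace2 r x = (\<Sum>i<r. x ^ (2 ^ i))"

definition canonical_char :: "nat \<Rightarrow> 'a::finite_field \<Rightarrow> real"
  where "canonical_char r x = (-1) ^ (if trace2 r x = 0 then 0 else 1)"

lemma CHAR_eq_2:
  assumes "CARD('a::finite_field) = 2 ^ r"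
  shows "CHAR('a) = 2"
proof -
  have "CHAR('a) dvd 2 ^ r"
    using CHAR_dvd_CARD[where 'a = 'a] assms by simp
  moreover have "prime CHAR('a)"
    by simp
  ultimately show ?thesis
    by (metis prime_dvd_power primes_dvd_imp_eq two_is_prime_nat)
qed

lemma trace2_cases:
  fixes x :: "'a::finite_field"
  assumes "CARD('a) = 2 ^ r"
  shows "trace2 r x = 0 \<or> trace2 r x = 1"
proof -
  have ch: "CHAR('a) = 2"
    using assms by (rule CHAR_eq_2)
  have "(trace2 r x)\<^sup>2 = (\<Sum>i<r. (x ^ (2 ^ i))\<^sup>2)"
    unfolding trace2_def by (rule freshmans_dream_sum) (simp_all add: ch)
  also have "\<dots> = (\<Sum>i<r. x ^ (2 ^ Suc i))"
    by (simp add: mult.commute flip: power_mult)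
  also have "\<dots> = (\<Sum>i<r. x ^ (2 ^ i)) + x ^ (2 ^ r) - x ^ (2 ^ 0)"
    by (induction r) (simp_all add: algebra_simps)
  also have "\<dots> = trace2 r x"
    using finite_field_power_card_eq_same[of x] assms by (simp add: trace2_def)
  finally have "trace2 r x * (trace2 r x - 1) = 0"
    by (simp add: power2_eq_square algebra_simps)
  then show ?thesis
    by simp
qed


section \<open>Kloosterman sums and their moments\<close>

definition unit_tuples :: "nat \<Rightarrow> 'a::finite_field list set"
  where "unit_tuples m = {as. length as = m \<and> 0 \<notin> set as}"

definition kloosterman :: "('a::finite_field \<Rightarrow> real) \<Rightarrow> nat \<Rightarrow> 'a \<Rightarrow> real"
  where "kloosterman \<psi> m a =
    (\<Sum>as\<in>unit_tuples m. \<psi> (sum_list as + a * prod_list (map inverse as)))"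

text \<open>For \<open>m = 0\<close> the only tuple is the empty one, so the usual convention is built in.\<close>

lemma kloosterman_0: "kloosterman \<psi> 0 a = \<psi> a"
proof -
  have "unit_tuples 0 = {[] :: 'a list}"
    by (auto simp: unit_tuples_def)
  then show ?thesis
    by (simp add: kloosterman_def)
qed

definition kloosterman_moment :: "('a::finite_field \<Rightarrow> real) \<Rightarrow> nat \<Rightarrow> nat \<Rightarrow> real"
  where "kloosterman_moment \<psi> m h = (\<Sum>a\<in>UNIV - {0}. kloosterman \<psi> m a ^ h)"


section \<open>The binary codes\<close>

definition kl_arg :: "'a::finite_field list \<Rightarrow> 'a"
  where "kl_arg as = sum_list as + prod_list (map inverse as)"

text \<open>The words orthogonal to a vector \<open>v\<close> with entries in a field of characteristic 2.\<close>

definition binary_code :: "'a::finite_field list \<Rightarrow> bit list set"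
  where "binary_code v =
    {u. length u = length v \<and> (\<Sum>i<length v. of_bit (u ! i) * v ! i) = 0}"

definition hamming_weight :: "bit list \<Rightarrow> nat"
  where "hamming_weight u = card {i. i < length u \<and> u ! i \<noteq> 0}"

definition weight_count :: "bit list set \<Rightarrow> nat \<Rightarrow> nat"
  where "weight_count C j = card {u \<in> C. hamming_weight u = j}"

text \<open>The number of \<open>m\<close>-tuples of units on which \<open>kl_arg\<close> takes the value \<open>\<beta>\<close>. The second
  parameter of the usual notation, the order of the field, is determined by the type.\<close>

definition kl_delta :: "nat \<Rightarrow> 'a::finite_field \<Rightarrow> nat"
  where "kl_delta m \<beta> = card {as \<in> unit_tuples m. kl_arg as = \<beta>}"


section \<open>Binomial coefficients and Stirling numbers\<close>

text \<open>Binomial coefficients with an integer lower index, vanishing when it is negative. Truncated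
  subtraction on natural numbers would turn a negative lower index into \<open>0\<close> and the
  coefficient into \<open>1\<close>.\<close>

definition binomial_int :: "nat \<Rightarrow> int \<Rightarrow> nat"
  where "binomial_int m k = (if k < 0 then 0 else m choose nat k)"

text \<open>The explicit formula for the Stirling numbers of the second kind.\<close>

lemma Stirling_explicit:
  "real (Stirling h t) = 1 / fact t * (\<Sum>j=0..t. (-1) ^ (t - j) * real (t choose j) * real j ^ h)"
proof -
  define A where "A h t = (\<Sum>j\<le>t. (-1) ^ (t - j) * real (t choose j) * real j ^ h)" for h t :: nat
  have A_Suc: "A (Suc h) (Suc t) = real (Suc t) * (A h (Suc t) + A h t)" for h t
  proof -
    have eq: "(-1) ^ (Suc t - j) * real (Suc t choose j) * real j ^ Suc h =
        real (Suc t) * ((-1) ^ (Suc t - j) * real (Suc t choose j) * real j ^ h +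
          (if j \<le> t then (-1) ^ (t - j) * real (t choose j) * real j ^ h else 0))"
      if "j \<le> Suc t" for j
    proof (cases "j = Suc t")
      case False
      then have j: "j \<le> t"
        using that by simp
      have "(Suc t - j) * (Suc t choose j) = Suc t * (t choose j)"
        using binomial_absorb_comp[of "Suc t" j] by simp
      then have "real (Suc t - j) * real (Suc t choose j) = real (Suc t) * real (t choose j)"
        by (metis of_nat_mult)
      then have b: "real j * real (Suc t choose j) =
          real (Suc t) * (real (Suc t choose j) - real (t choose j))"
        using j by (simp add: of_nat_diff algebra_simps)
      have "(-1) ^ (Suc t - j) * real (Suc t choose j) * real j ^ Suc h =
          (-1) ^ (Suc t - j) * real j ^ h * (real j * real (Suc t choose j))"
        by simp
      also have "\<dots> = (-1) ^ (Suc t - j) * real j ^ h *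
          (real (Suc t) * (real (Suc t choose j) - real (t choose j)))"
        by (simp only: b)
      also have "(-1) ^ (Suc t - j) = - ((-1) ^ (t - j) :: real)"
        using j by (simp add: Suc_diff_le)
      finally show ?thesis
        using j by (simp add: Suc_diff_le algebra_simps)
    qed simp
    have "A (Suc h) (Suc t) = (\<Sum>j\<le>Suc t. real (Suc t) *
        ((-1) ^ (Suc t - j) * real (Suc t choose j) * real j ^ h +
          (if j \<le> t then (-1) ^ (t - j) * real (t choose j) * real j ^ h else 0)))"
      unfolding A_def by (rule sum.cong[OF refl]) (rule eq, simp)
    also have "\<dots> = real (Suc t) * (A h (Suc t) +
        (\<Sum>j\<le>Suc t. if j \<le> t then (-1) ^ (t - j) * real (t choose j) * real j ^ h else 0))"
      unfolding A_def by (simp only: sum_distrib_left[symmetric] sum.distrib)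
    also have "(\<Sum>j\<le>Suc t. if j \<le> t then (-1) ^ (t - j) * real (t choose j) * real j ^ h else 0) = A h t"
      unfolding A_def by simp
    finally show ?thesis .
  qed
  have A_0: "A 0 t = (if t = 0 then 1 else 0)" for t
  proof -
    have "A 0 t = (1 + (-1)) ^ t"
      unfolding A_def by (subst binomial_ring) (simp add: mult.commute)
    then show ?thesis
      by simp
  qed
  have "fact t * real (Stirling h t) = A h t"
  proof (induction h t rule: Stirling.induct)
    case (3 n)
    then show ?case
      by (simp add: A_def)
  next
    case (4 n k)
    have "fact (Suc k) * real (Stirling (Suc n) (Suc k)) =
        real (Suc k) * (fact (Suc k) * real (Stirling n (Suc k)) + fact k * real (Stirling n k))"
      by (simp add: algebra_simps)
    then show ?case
      using 4 A_Suc by simp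
  qed (simp_all add: A_0)
  then show ?thesis
    by (simp add: A_def field_simps atMost_atLeast0)
qed

end

(* Write w(a) for the number of tuples with canonical character -1 at a * kl_arg; this is the weight
   of the trace word of a, which runs through the dual of C. As n is a power of two, substitution and
   Frobenius give K(a) = N - 2 w(a) for a nonzero, and w(0) = 0. Expanding (N - K(a))^h binomially,
   the moment recursion becomes the Pless power moment identity for the w(a), which is the
   orthogonality relation applied to zero-sum subsets of the tuples. The numbers kl_delta come from
   orthogonality together with the same evaluation of K. *)

theory Submission
  imports Defs
begin

section \<open>Counting subsets\<close>

text \<open>Rewrites powers in terms of binomial coefficients, which count subsets and can thus be
  matched with codeword counts. In the induction, multiplication by \<open>x\<close> turns
  \<open>x choose t\<close> into a combination of \<open>x choose t\<close> and
  \<open>x choose Suc t\<close>, which reproduces the Stirling recurrence.\<close>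

lemma pow_eq_sum_Stirling:
  "(x :: nat) ^ h = (\<Sum>t\<le>h. fact t * Stirling h t * (x choose t))"
proof (induction h)
  case (Suc h)
  have absorb: "x * (x choose t) = t * (x choose t) + Suc t * (x choose Suc t)" for t
  proof (cases "t \<le> x")
    case True
    then have "x * (x choose t) = t * (x choose t) + (x - t) * (x choose t)"
      by (simp flip: add_mult_distrib)
    then show ?thesis
      by (metis binomial_absorb_comp binomial_absorption)
  qed (simp add: binomial_eq_0)
  have "x ^ Suc h = (\<Sum>t\<le>h. fact t * Stirling h t * (x * (x choose t)))"
    by (simp add: Suc sum_distrib_left mult_ac)
  also have "\<dots> = (\<Sum>t\<le>h. t * fact t * Stirling h t * (x choose t)) +
      (\<Sum>t\<le>h. fact (Suc t) * Stirling h t * (x choose Suc t))"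
    by (simp only: absorb) (simp add: algebra_simps sum.distrib)
  also have "(\<Sum>t\<le>h. t * fact t * Stirling h t * (x choose t)) =
      (\<Sum>t\<le>Suc h. t * fact t * Stirling h t * (x choose t))"
    by simp
  also have "\<dots> = (\<Sum>t\<le>h. Suc t * fact (Suc t) * Stirling h (Suc t) * (x choose Suc t))"
    by (subst sum.atMost_Suc_shift) simp
  also have "(\<Sum>t\<le>h. Suc t * fact (Suc t) * Stirling h (Suc t) * (x choose Suc t)) +
      (\<Sum>t\<le>h. fact (Suc t) * Stirling h t * (x choose Suc t)) =
      (\<Sum>t\<le>h. fact (Suc t) * Stirling (Suc h) (Suc t) * (x choose Suc t))"
    unfolding sum.distrib[symmetric] by (rule sum.cong) (simp_all add: algebra_simps)
  also have "\<dots> = (\<Sum>t\<le>Suc h. fact t * Stirling (Suc h) t * (x choose t))"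
    by (subst sum.atMost_Suc_shift) simp
  finally show ?case .
qed simp

text \<open>Deleting \<open>J\<close> identifies the supersets with subsets of \<open>U - J\<close>
  of size \<open>t - card J\<close>. The case distinction is essential: for
  \<open>card J > t\<close> truncated subtraction would give a binomial coefficient equal to 1
  instead of 0.\<close>

lemma card_supersets:
  assumes "finite U" "J \<subseteq> U"
  shows "card {T. J \<subseteq> T \<and> T \<subseteq> U \<and> card T = t} =
    (if card J \<le> t then (card U - card J) choose (t - card J) else 0)"
proof (cases "card J \<le> t")
  case True
  have fin: "finite J"
    using assms finite_subset by blast
  have "bij_betw (\<lambda>T. T - J) {T. J \<subseteq> T \<and> T \<subseteq> U \<and> card T = t}
      {T. T \<subseteq> U - J \<and> card T = t - card J}"
  proof (rule bij_betw_byWitness[where f' = "\<lambda>T. T \<union> J"])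
    show "(\<lambda>T. T \<union> J) ` {T. T \<subseteq> U - J \<and> card T = t - card J} \<subseteq>
        {T. J \<subseteq> T \<and> T \<subseteq> U \<and> card T = t}"
    proof clarify
      fix T assume T: "T \<subseteq> U - J" "card T = t - card J"
      then have "card (T \<union> J) = card T + card J"
        using assms fin finite_subset by (intro card_Un_disjoint) blast+
      then show "J \<subseteq> T \<union> J \<and> T \<union> J \<subseteq> U \<and> card (T \<union> J) = t"
        using T True assms by auto
    qed
  qed (use fin in \<open>auto simp: card_Diff_subset\<close>)
  then have "card {T. J \<subseteq> T \<and> T \<subseteq> U \<and> card T = t} = card (U - J) choose (t - card J)"
    using assms by (simp add: bij_betw_same_card n_subsets)
  then show ?thesis
    using True assms fin by (simp add: card_Diff_subset)
next
  case False
  have "card J \<le> card T" if "J \<subseteq> T" "T \<subseteq> U" for T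
    using that assms by (meson card_mono finite_subset)
  then have empty: "{T. J \<subseteq> T \<and> T \<subseteq> U \<and> card T = t} = {}"
    using False by blast
  show ?thesis
    unfolding empty using False by simp
qed

section \<open>Zero-sum subsets and codewords\<close>

lemma card_subsets_with_profile:
  fixes f :: "'b \<Rightarrow> 'a::finite"
  assumes "finite U"
  shows "card {T. T \<subseteq> U \<and> (\<forall>\<beta>. card {x\<in>T. f x = \<beta>} = \<nu> \<beta>)} =
    (\<Prod>\<beta>\<in>UNIV. card {x\<in>U. f x = \<beta>} choose \<nu> \<beta>)"
proof -
  let ?S = "\<lambda>\<beta>. {T. T \<subseteq> {x\<in>U. f x = \<beta>} \<and> card T = \<nu> \<beta>}"
  \<comment> \<open>A subset is the disjoint union of its fibres, and the fibres over different
    values can be chosen independently.\<close>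
  have "bij_betw (\<lambda>T \<beta>. {x\<in>T. f x = \<beta>}) {T. T \<subseteq> U \<and> (\<forall>\<beta>. card {x\<in>T. f x = \<beta>} = \<nu> \<beta>)}
      (PiE UNIV ?S)"
  proof (rule bij_betw_byWitness[where f' = "\<lambda>S. \<Union>\<beta>. S \<beta>"])
    have fibre: "{x \<in> (\<Union>\<beta>. S \<beta>). f x = \<beta>} = S \<beta>" if "S \<in> PiE UNIV ?S" for S \<beta>
      using that by (fastforce simp: PiE_iff)
    then show "\<forall>S\<in>PiE UNIV ?S. (\<lambda>\<beta>. {x \<in> (\<Union>\<beta>. S \<beta>). f x = \<beta>}) = S"
      by blast
    show "(\<lambda>S. \<Union>\<beta>. S \<beta>) ` PiE UNIV ?S \<subseteq> {T. T \<subseteq> U \<and> (\<forall>\<beta>. card {x\<in>T. f x = \<beta>} = \<nu> \<beta>)}"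
      using fibre by (fastforce simp: PiE_iff)
  qed (auto simp: PiE_iff)
  then have "card {T. T \<subseteq> U \<and> (\<forall>\<beta>. card {x\<in>T. f x = \<beta>} = \<nu> \<beta>)} = card (PiE UNIV ?S)"
    by (rule bij_betw_same_card)
  then show ?thesis
    using assms by (simp add: card_PiE n_subsets)
qed

text \<open>Size and sum of a subset depend only on how many of its elements \<open>f\<close> sends
  to each \<beta>. Grouping subsets by this profile reduces the count to independent choices within
  the fibres.\<close>

lemma card_zero_sum_subsets:
  fixes f :: "'b \<Rightarrow> 'a::finite_field"
  assumes "finite U"
  shows "card {T. T \<subseteq> U \<and> sum f T = 0 \<and> card T = j} =
    (\<Sum>\<nu> | (\<forall>\<beta>. \<nu> \<beta> \<le> card {x\<in>U. f x = \<beta>}) \<and> (\<Sum>\<beta>\<in>UNIV. \<nu> \<beta>) = j \<and>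
        (\<Sum>\<beta>\<in>UNIV. of_nat (\<nu> \<beta>) * \<beta>) = 0.
      \<Prod>\<beta>\<in>UNIV. card {x\<in>U. f x = \<beta>} choose \<nu> \<beta>)" (is "card ?A = sum _ ?V")
proof -
  let ?profile = "\<lambda>T \<beta>. card {x\<in>T. f x = \<beta>}"
  have V: "finite ?V"
    by (rule finite_subset[OF _ finite_PiE[of UNIV "\<lambda>\<beta>. {..card {x\<in>U. f x = \<beta>}}"]]) auto
  have A: "finite ?A"
    using assms by simp
  have card: "(\<Sum>\<beta>\<in>UNIV. ?profile T \<beta>) = card T"
    and sum: "(\<Sum>\<beta>\<in>UNIV. of_nat (?profile T \<beta>) * \<beta>) = sum f T" if "T \<subseteq> U" for T
  proof -
    have fin: "finite T"
      using that assms finite_subset by blast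
    show "(\<Sum>\<beta>\<in>UNIV. ?profile T \<beta>) = card T"
      using sum.group[OF fin, of UNIV f "\<lambda>_. 1 :: nat"] by simp
    have "(\<Sum>\<beta>\<in>UNIV. of_nat (?profile T \<beta>) * \<beta>) = (\<Sum>\<beta>\<in>UNIV. sum f {x\<in>T. f x = \<beta>})"
      by (intro sum.cong) simp_all
    then show "(\<Sum>\<beta>\<in>UNIV. of_nat (?profile T \<beta>) * \<beta>) = sum f T"
      using sum.group[OF fin, of UNIV f f] by simp
  qed
  have le: "?profile T \<beta> \<le> ?profile U \<beta>" if "T \<subseteq> U" for T \<beta>
    using that assms by (intro card_mono) auto
  have "card ?A = (\<Sum>\<nu>\<in>?V. card {T\<in>?A. ?profile T = \<nu>})"
    using sum.group[OF A V, of ?profile "\<lambda>_. 1 :: nat"] card sum le by fastforce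
  also have "\<dots> = (\<Sum>\<nu>\<in>?V. card {T. T \<subseteq> U \<and> (\<forall>\<beta>. ?profile T \<beta> = \<nu> \<beta>)})"
  proof (rule sum.cong[OF refl])
    fix \<nu> assume "\<nu> \<in> ?V"
    then have "{T\<in>?A. ?profile T = \<nu>} = {T. T \<subseteq> U \<and> (\<forall>\<beta>. ?profile T \<beta> = \<nu> \<beta>)}"
      using card[symmetric] sum[symmetric] by (auto simp: fun_eq_iff)
    then show "card {T\<in>?A. ?profile T = \<nu>} = card {T. T \<subseteq> U \<and> (\<forall>\<beta>. ?profile T \<beta> = \<nu> \<beta>)}"
      by simp
  qed
  finally show ?thesis
    by (simp only: card_subsets_with_profile[OF assms])
qed

text \<open>A word is determined by its support, and distinctness of \<open>xs\<close> lets
  positions be replaced by entries. The subsets are taken in \<open>set xs\<close>, not among the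
  values of \<open>f\<close>, because \<open>f\<close> may repeat a value at several
  positions.\<close>

lemma weight_count_binary_code:
  fixes xs :: "'b list" and f :: "'b \<Rightarrow> 'a::finite_field"
  assumes "distinct xs"
  shows "weight_count (binary_code (map f xs)) j =
    card {T. T \<subseteq> set xs \<and> sum f T = 0 \<and> card T = j}"
proof -
  let ?supp = "\<lambda>u. {i. i < length xs \<and> u ! i \<noteq> (0 :: bit)}"
  let ?B = "{I. I \<subseteq> {..<length xs} \<and> (\<Sum>i\<in>I. f (xs ! i)) = 0 \<and> card I = j}"
  have eq: "(\<Sum>i<length xs. of_bit (u ! i) * map f xs ! i) = (\<Sum>i\<in>?supp u. f (xs ! i))" for u
  proof -
    have "(\<Sum>i<length xs. of_bit (u ! i) * map f xs ! i) =
        (\<Sum>i<length xs. if u ! i \<noteq> 0 then f (xs ! i) else 0)"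
      by (intro sum.cong) auto
    then show ?thesis
      by (simp add: sum.If_cases Int_def)
  qed
  have inj: "inj_on ((!) xs) {..<length xs}"
    using assms by (simp add: inj_on_nth)
  have "bij_betw ?supp {u \<in> binary_code (map f xs). hamming_weight u = j} ?B"
  proof (rule bij_betw_byWitness[where f' = "\<lambda>I. map (\<lambda>i. of_bool (i \<in> I)) [0..<length xs]"])
    show "\<forall>I\<in>?B. ?supp (map (\<lambda>i. of_bool (i \<in> I)) [0..<length xs]) = I"
      by auto
    then show "(\<lambda>I. map (\<lambda>i. of_bool (i \<in> I)) [0..<length xs]) ` ?B \<subseteq>
        {u \<in> binary_code (map f xs). hamming_weight u = j}"
      using eq by (auto simp: binary_code_def hamming_weight_def)
    show "\<forall>u\<in>{u \<in> binary_code (map f xs). hamming_weight u = j}.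
        map (\<lambda>i. of_bool (i \<in> ?supp u)) [0..<length xs] = u"
      by (auto simp: binary_code_def intro!: nth_equalityI)
    show "?supp ` {u \<in> binary_code (map f xs). hamming_weight u = j} \<subseteq> ?B"
      using eq by (auto simp: binary_code_def hamming_weight_def)
  qed
  then have "weight_count (binary_code (map f xs)) j = card ?B"
    unfolding weight_count_def by (rule bij_betw_same_card)
  also have "bij_betw ((`) ((!) xs)) ?B {T. T \<subseteq> set xs \<and> sum f T = 0 \<and> card T = j}"
  proof (rule bij_betw_imageI)
    show "inj_on ((`) ((!) xs)) ?B"
      using inj_on_image_Pow[OF inj] by (rule inj_on_subset) auto
    have props: "sum f ((!) xs ` I) = (\<Sum>i\<in>I. f (xs ! i))" "card ((!) xs ` I) = card I"
      if "I \<subseteq> {..<length xs}" for I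
      using inj_on_subset[OF inj that] by (simp_all add: sum.reindex card_image)
    have img: "(!) xs ` {..<length xs} = set xs"
      by (auto simp: set_conv_nth)
    show "(`) ((!) xs) ` ?B = {T. T \<subseteq> set xs \<and> sum f T = 0 \<and> card T = j}"
    proof (intro equalityI subsetI)
      fix T assume T: "T \<in> {T. T \<subseteq> set xs \<and> sum f T = 0 \<and> card T = j}"
      then obtain I where "I \<subseteq> {..<length xs}" "T = (!) xs ` I"
        unfolding img[symmetric] by (auto elim: subset_imageE)
      then show "T \<in> (`) ((!) xs) ` ?B"
        using T props by auto
    next
      fix T assume "T \<in> (`) ((!) xs) ` ?B"
      then show "T \<in> {T. T \<subseteq> set xs \<and> sum f T = 0 \<and> card T = j}"
        using props img by auto
    qed
  qed
  then have "card ?B = card {T. T \<subseteq> set xs \<and> sum f T = 0 \<and> card T = j}"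
    by (rule bij_betw_same_card)
  finally show ?thesis .
qed

text \<open>The factor \<open>1 - \<epsilon> x\<close> is 2 where the sign is -1 and 0 elsewhere, so
  a product survives exactly when all of \<open>T\<close> has sign -1. This makes the binomial
  coefficient of a weight accessible to character sums.\<close>

lemma binomial_weight_expansion:
  fixes \<epsilon> :: "'b \<Rightarrow> real"
  assumes "finite U" and sign: "\<And>x. x \<in> U \<Longrightarrow> \<epsilon> x = 1 \<or> \<epsilon> x = -1"
  shows "2 ^ t * real (card {x\<in>U. \<epsilon> x = -1} choose t) =
    (\<Sum>T | T \<subseteq> U \<and> card T = t. \<Prod>x\<in>T. 1 - \<epsilon> x)"
proof -
  let ?W = "{x\<in>U. \<epsilon> x = -1}"
  have prod: "(\<Prod>x\<in>T. 1 - \<epsilon> x) = (if T \<subseteq> ?W then 2 ^ card T else 0)" if T: "T \<subseteq> U" for T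
  proof (cases "T \<subseteq> ?W")
    case True
    then have "(\<Prod>x\<in>T. 1 - \<epsilon> x) = (\<Prod>x\<in>T. 2)"
      by (intro prod.cong) auto
    then show ?thesis
      using True by simp
  next
    case False
    moreover have "finite T"
      using T assms(1) finite_subset by blast
    ultimately show ?thesis
      using T sign by (auto simp: prod_zero_iff)
  qed
  have "(\<Sum>T | T \<subseteq> U \<and> card T = t. \<Prod>x\<in>T. 1 - \<epsilon> x) =
      (\<Sum>T | T \<subseteq> ?W \<and> card T = t. 2 ^ t)"
  proof (intro sum.mono_neutral_cong_right)
    show "(\<Prod>x\<in>T. 1 - \<epsilon> x) = 2 ^ t" if "T \<in> {T. T \<subseteq> ?W \<and> card T = t}" for T
      using that prod[of T] by auto
  qed (use assms(1) in \<open>auto simp: prod\<close>)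
  then show ?thesis
    using assms(1) by (simp add: n_subsets)
qed

section \<open>The canonical character and tuples of units\<close>

lemma finite_unit_tuples [simp]: "finite (unit_tuples m :: 'a::finite_field list set)"
  unfolding unit_tuples_def
  by (rule finite_subset[OF _ finite_lists_length_eq[of UNIV m]]) auto

lemma sum_unit_tuples_Suc:
  "(\<Sum>as\<in>unit_tuples (Suc m). F as) = (\<Sum>a\<in>UNIV - {0 :: 'a::finite_field}. \<Sum>as\<in>unit_tuples m. F (a # as))"
proof -
  have "(\<Sum>as\<in>unit_tuples (Suc m). F as) =
      (\<Sum>(a, as)\<in>(UNIV - {0 :: 'a}) \<times> unit_tuples m. F (a # as))"
    by (rule sum.reindex_bij_witness[of _ "\<lambda>(a, as). a # as" "\<lambda>as. (hd as, tl as)"])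
      (auto simp: unit_tuples_def length_Suc_conv)
  then show ?thesis
    by (simp add: sum.cartesian_product)
qed

lemma unit_tuples_0 [simp]: "unit_tuples 0 = {[] :: 'a::finite_field list}"
  by (auto simp: unit_tuples_def)

lemma prod_list_map_power:
  "prod_list (map (\<lambda>x. f x ^ k) as) = prod_list (map f as :: 'a::comm_monoid_mult list) ^ k"
  by (induction as) (simp_all add: power_mult_distrib)

lemma prod_list_map_inverse: "prod_list (map inverse as) = inverse (prod_list (as :: 'a::field list))"
  by (induction as) simp_all

lemma prod_list_map_mult:
  "prod_list (map (\<lambda>x. x * c) as) = prod_list as * (c :: 'a::comm_monoid_mult) ^ length as"
  by (induction as) (simp_all add: mult_ac)

lemma prod_list_unit_tuples: "as \<in> unit_tuples m \<Longrightarrow> prod_list as \<noteq> (0 :: 'a::finite_field)"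
  by (auto simp: unit_tuples_def prod_list_zero_iff)

lemma canonical_char_cases: "canonical_char r (x :: 'a::finite_field) = 1 \<or> canonical_char r x = -1"
  by (simp add: canonical_char_def)

lemma canonical_char_0 [simp]: "canonical_char r (0 :: 'a::finite_field) = 1"
  by (simp add: canonical_char_def trace2_def power_0_left)

context
  fixes r :: nat
  assumes card_field: "CARD('a::finite_field) = 2 ^ r"
begin

lemma trace2_add: "trace2 r (x + y :: 'a) = trace2 r x + trace2 r y"
proof -
  have "(x + y) ^ 2 ^ i = x ^ 2 ^ i + y ^ 2 ^ i" for i
    by (rule freshmans_dream') (simp_all add: CHAR_eq_2[OF card_field])
  then show ?thesis
    by (simp add: trace2_def sum.distrib)
qed

text \<open>Squaring shifts the summation index by one, and the two end terms agree because
  \<open>x ^ (2 ^ r) = x\<close>.\<close>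

lemma trace2_square: "trace2 r (x ^ 2 :: 'a) = trace2 r x"
proof -
  have "trace2 r (x ^ 2) = (\<Sum>i<r. x ^ (2 ^ Suc i))"
    by (simp add: trace2_def flip: power_mult)
  also have "\<dots> = (\<Sum>i<r. x ^ (2 ^ i)) + x ^ (2 ^ r) - x ^ (2 ^ 0)"
    by (induction r) (simp_all add: algebra_simps)
  also have "\<dots> = trace2 r x"
    using finite_field_power_card_eq_same[of x] card_field by (simp add: trace2_def)
  finally show ?thesis .
qed

text \<open>As a polynomial the trace is nonzero of degree at most \<open>2 ^ (r - 1)\<close>, which
  is less than the number of field elements, so it cannot vanish everywhere.\<close>

lemma ex_trace2_eq_1: "\<exists>x :: 'a. trace2 r x = 1"
proof (rule ccontr)
  assume "\<not> ?thesis"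
  then have all0: "trace2 r x = 0" for x :: 'a
    using trace2_cases[OF card_field] by blast
  have "card {0, 1 :: 'a} \<le> CARD('a)"
    by (rule card_mono) simp_all
  then have r: "r > 0"
    using card_field by (cases r) auto
  define p :: "'a poly" where "p = (\<Sum>i<r. Polynomial.monom 1 (2 ^ i))"
  have eval: "poly p x = trace2 r x" for x
    by (simp add: p_def poly_sum poly_monom trace2_def)
  \<comment> \<open>The linear coefficient comes from \<open>i = 0\<close> alone, since
    \<open>2 ^ i = 1\<close> only there.\<close>
  have "Polynomial.coeff p 1 = (\<Sum>i<r. if i = 0 then 1 else 0)"
    unfolding p_def Polynomial.coeff_sum by (rule sum.cong) auto
  then have "p \<noteq> 0"
    using r by auto
  then have "card {x. poly p x = 0} \<le> degree p"
    by (rule card_poly_roots_bound)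
  then have "2 ^ r \<le> degree p"
    using card_field by (simp add: eval all0)
  also have "degree p \<le> 2 ^ (r - 1)"
    unfolding p_def
  proof (rule degree_sum_le)
    fix i assume "i \<in> {..<r}"
    then show "degree (Polynomial.monom (1 :: 'a) (2 ^ i)) \<le> 2 ^ (r - 1)"
      by (simp add: degree_monom_eq)
  qed simp
  also have "(2 :: nat) ^ (r - 1) < 2 ^ r"
    using r by simp
  finally show False
    by simp
qed

lemma canonical_char_add:
  "canonical_char r (x + y :: 'a) = canonical_char r x * canonical_char r y"
proof -
  \<comment> \<open>Two traces equal to 1 add up to 0, matching the product of two signs -1.\<close>
  have "(1 :: 'a) + 1 = 0"
    using of_nat_CHAR[where 'a = 'a] by (simp add: CHAR_eq_2[OF card_field])
  then show ?thesis
    using trace2_cases[OF card_field, of x] trace2_cases[OF card_field, of y]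
    by (auto simp: canonical_char_def trace2_add)
qed

lemma canonical_char_sum:
  "canonical_char r (\<Sum>x\<in>A. f x :: 'a) = (\<Prod>x\<in>A. canonical_char r (f x))"
  by (induction A rule: infinite_finite_induct) (simp_all add: canonical_char_add)

lemma canonical_char_power2_power: "canonical_char r (x ^ 2 ^ s :: 'a) = canonical_char r x"
proof (induction s)
  case (Suc s)
  have "canonical_char r (x ^ 2 ^ Suc s) = canonical_char r ((x ^ 2 ^ s) ^ 2)"
    by (simp add: mult.commute flip: power_mult)
  also have "\<dots> = canonical_char r (x ^ 2 ^ s)"
    by (simp add: canonical_char_def trace2_square)
  finally show ?case
    using Suc by simp
qed simp

section \<open>Orthogonality of the additive characters\<close>

lemma sum_canonical_char: "(\<Sum>x\<in>UNIV. canonical_char r (x :: 'a)) = 0"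
proof -
  obtain c :: 'a where c: "trace2 r c = 1"
    using ex_trace2_eq_1 by blast
  \<comment> \<open>Translation by an element of trace 1 permutes the field and flips every sign, so
    the sum equals its own negative.\<close>
  have "(\<Sum>x\<in>UNIV. canonical_char r (x :: 'a)) = (\<Sum>x\<in>UNIV. canonical_char r (x + c))"
    by (rule sum.reindex_bij_witness[of _ "\<lambda>x. x + c" "\<lambda>x. x - c"]) auto
  also have "\<dots> = - (\<Sum>x\<in>UNIV. canonical_char r (x :: 'a))"
    using c by (simp add: canonical_char_add canonical_char_def[of r c] sum_negf)
  finally show ?thesis
    by simp
qed

lemma canonical_char_orthogonality:
  "(\<Sum>x\<in>UNIV. canonical_char r (x * c :: 'a)) = (if c = 0 then 2 ^ r else 0)"
proof (cases "c = 0")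
  case True
  then show ?thesis
    using card_field by simp
next
  case False
  then have "(\<Sum>x\<in>UNIV. canonical_char r (x * c)) = (\<Sum>x\<in>UNIV. canonical_char r (x :: 'a))"
    by (intro sum.reindex_bij_witness[of _ "\<lambda>x. x / c" "\<lambda>x. x * c"]) auto
  then show ?thesis
    using False by (simp add: sum_canonical_char)
qed

lemma canonical_char_orthogonality_nonzero:
  "(\<Sum>x\<in>UNIV - {0}. canonical_char r (x * c :: 'a)) = (if c = 0 then 2 ^ r else 0) - 1"
  by (simp add: sum_diff1 canonical_char_orthogonality)

section \<open>Kloosterman sums\<close>

lemma card_unit_tuples: "card (unit_tuples m :: 'a list set) = (2 ^ r - 1) ^ m"
proof (induction m)
  case (Suc m)
  have "card (unit_tuples (Suc m) :: 'a list set) = card (UNIV - {0 :: 'a}) * card (unit_tuples m :: 'a list set)"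
    unfolding card_eq_sum sum_unit_tuples_Suc by simp
  then show ?case
    using Suc card_field by (simp add: card_Diff_singleton)
qed simp

lemma sum_list_map_power:
  "sum_list (map (\<lambda>x. x ^ 2 ^ s) as) = (sum_list as :: 'a) ^ 2 ^ s"
  by (induction as)
    (simp_all add: power_0_left freshmans_dream'[of "2 ^ s" s] CHAR_eq_2[OF card_field])

lemma inj_frobenius_power: "inj (\<lambda>x :: 'a. x ^ 2 ^ s)"
proof (rule injI)
  fix x y :: 'a
  assume "x ^ 2 ^ s = y ^ 2 ^ s"
  \<comment> \<open>Writing \<open>x\<close> as \<open>x - y + y\<close> lets additivity of the
    power isolate \<open>(x - y) ^ 2 ^ s\<close>, which must then vanish.\<close>
  then have "(x - y + y) ^ 2 ^ s = y ^ 2 ^ s"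
    by simp
  then have "(x - y) ^ 2 ^ s + y ^ 2 ^ s = y ^ 2 ^ s"
    by (subst (asm) freshmans_dream'[of "2 ^ s" s]) (simp_all add: CHAR_eq_2[OF card_field])
  then show "x = y"
    by simp
qed

text \<open>The Frobenius power permutes the tuples of units and can be pulled out of the whole
  argument of the character, whose value it leaves unchanged.\<close>

lemma kloosterman_power2_power:
  "kloosterman (canonical_char r) m (a ^ 2 ^ s :: 'a) = kloosterman (canonical_char r) m a"
proof -
  let ?g = "map (\<lambda>x :: 'a. x ^ 2 ^ s)"
  have inj: "inj_on ?g (unit_tuples m)"
    using inj_frobenius_power by (rule inj_on_mapI[OF inj_on_subset]) simp
  have "?g ` unit_tuples m \<subseteq> unit_tuples m"
    by (auto simp: unit_tuples_def)
  then have bij: "bij_betw ?g (unit_tuples m) (unit_tuples m)"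
    using inj by (simp add: bij_betw_def endo_inj_surj)
  have "kloosterman (canonical_char r) m (a ^ 2 ^ s) =
      (\<Sum>as\<in>unit_tuples m. canonical_char r
        (sum_list (?g as) + a ^ 2 ^ s * prod_list (map inverse (?g as))))"
    unfolding kloosterman_def by (rule sum.reindex_bij_betw[OF bij, symmetric])
  also have "\<dots> = (\<Sum>as\<in>unit_tuples m. canonical_char r
      ((sum_list as + a * prod_list (map inverse as)) ^ 2 ^ s))"
  proof (rule sum.cong[OF refl])
    fix as :: "'a list"
    have "sum_list (?g as) + a ^ 2 ^ s * prod_list (map inverse (?g as)) =
        sum_list as ^ 2 ^ s + (a * prod_list (map inverse as)) ^ 2 ^ s"
      unfolding prod_list_map_inverse sum_list_map_power
      by (simp add: prod_list_map_power[of "\<lambda>x. x", simplified] power_mult_distrib power_inverse)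
    also have "\<dots> = (sum_list as + a * prod_list (map inverse as)) ^ 2 ^ s"
      by (rule freshmans_dream'[of "2 ^ s" s, symmetric]) (simp_all add: CHAR_eq_2[OF card_field])
    finally show "canonical_char r (sum_list (?g as) + a ^ 2 ^ s * prod_list (map inverse (?g as))) =
        canonical_char r ((sum_list as + a * prod_list (map inverse as)) ^ 2 ^ s)"
      by simp
  qed
  finally show ?thesis
    by (simp add: canonical_char_power2_power kloosterman_def)
qed

text \<open>The substitution \<open>\<alpha> \<mapsto> \<alpha> / a\<close> turns the left-hand side into the Kloosterman sum at
  \<open>a ^ (m + 1)\<close>. Since \<open>m + 1\<close> is a power of two, Frobenius invariance of the trace reduces
  this to the sum at \<open>a\<close>.\<close>

lemma sum_canonical_char_kl_arg:
  fixes a :: 'a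
  assumes a: "a \<noteq> 0" and m: "Suc m = 2 ^ s"
  shows "(\<Sum>as\<in>unit_tuples m. canonical_char r (a * kl_arg as)) = kloosterman (canonical_char r) m a"
proof -
  have "(\<Sum>as\<in>unit_tuples m. canonical_char r (a * kl_arg as)) =
      (\<Sum>as\<in>unit_tuples m. canonical_char r
        (sum_list as + a ^ 2 ^ s * prod_list (map inverse as)))"
  proof (rule sum.reindex_bij_witness[of _ "map (\<lambda>x. x * inverse a)" "map (\<lambda>x. x * a)"])
    fix as :: "'a list"
    assume as: "as \<in> unit_tuples m"
    then have len: "length as = m"
      by (simp add: unit_tuples_def)
    show "map (\<lambda>x. x * inverse a) (map (\<lambda>x. x * a) as) = as"
      "map (\<lambda>x. x * a) (map (\<lambda>x. x * inverse a) as) = as"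
      using a by (simp_all add: comp_def mult.assoc)
    show "map (\<lambda>x. x * a) as \<in> unit_tuples m" "map (\<lambda>x. x * inverse a) as \<in> unit_tuples m"
      using as a by (auto simp: unit_tuples_def)
    have "a ^ 2 ^ s * prod_list (map inverse (map (\<lambda>x. x * a) as)) =
        a ^ Suc m * inverse (prod_list as * a ^ m)"
      unfolding prod_list_map_inverse prod_list_map_mult len m ..
    also have "\<dots> = a * inverse (prod_list as)"
      using a by simp
    finally show "canonical_char r (sum_list (map (\<lambda>x. x * a) as) + a ^ 2 ^ s *
        prod_list (map inverse (map (\<lambda>x. x * a) as))) = canonical_char r (a * kl_arg as)"
      by (simp add: kl_arg_def prod_list_map_inverse sum_list_mult_const ring_distribs mult.commute)
  qed
  also have "\<dots> = kloosterman (canonical_char r) m (a ^ 2 ^ s)"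
    by (simp add: kloosterman_def)
  finally show ?thesis
    by (simp add: kloosterman_power2_power)
qed

section \<open>Value distribution of \<open>kl_arg\<close> on tuples of units\<close>

lemma sum_canonical_char_sum_list:
  "(\<Sum>as\<in>unit_tuples m. canonical_char r (sum_list as :: 'a)) = (-1) ^ m"
proof (induction m)
  case (Suc m)
  have "(\<Sum>x\<in>UNIV - {0 :: 'a}. canonical_char r x) = -1"
    by (simp add: sum_diff1 sum_canonical_char)
  then show ?case
    using Suc by (simp add: sum_unit_tuples_Suc canonical_char_add
        flip: sum_distrib_left sum_distrib_right)
qed simp

text \<open>Prescribing the product determines the first coordinate from the other \<open>m\<close>,
  which remain free. This is how a Kloosterman sum of one dimension less arises.\<close>

lemma sum_canonical_char_fixed_product:
  assumes "\<beta> \<noteq> (0 :: 'a)"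
  shows "(\<Sum>as\<in>unit_tuples (Suc m). canonical_char r (sum_list as) *
      (if prod_list (map inverse as) = \<beta> then 1 else 0)) =
    kloosterman (canonical_char r) m (inverse \<beta>)"
proof -
  have "(\<Sum>a\<in>UNIV - {0}. canonical_char r (sum_list (a # as)) *
      (if prod_list (map inverse (a # as)) = \<beta> then 1 else 0)) =
      canonical_char r (sum_list as + inverse \<beta> * prod_list (map inverse as))"
    if as: "as \<in> unit_tuples m" for as
  proof -
    define c where "c = inverse \<beta> * prod_list (map inverse as)"
    have p: "prod_list as \<noteq> 0"
      using as by (rule prod_list_unit_tuples)
    then have c: "c \<in> UNIV - {0}"
      using assms by (simp add: c_def prod_list_map_inverse)
    have "(\<Sum>a\<in>UNIV - {0}. canonical_char r (sum_list (a # as)) *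
        (if prod_list (map inverse (a # as)) = \<beta> then 1 else 0)) =
        (\<Sum>a\<in>UNIV - {0}. if a = c then canonical_char r (a + sum_list as) else 0)"
      using p assms by (intro sum.cong) (auto simp: c_def prod_list_map_inverse field_simps)
    also have "\<dots> = canonical_char r (c + sum_list as)"
      using c by (subst sum.delta) auto
    finally show ?thesis
      by (simp add: c_def add.commute)
  qed
  then show ?thesis
    unfolding sum_unit_tuples_Suc kloosterman_def
    by (subst sum.swap) (rule sum.cong, auto)
qed

text \<open>Orthogonality is used twice: first to detect \<open>kl_arg as = \<beta>\<close>, then,
  after the inner sums have been recognised as Kloosterman sums and written out again, to turn the
  sum over \<open>a\<close> into a condition on the product of the inverses alone.\<close>

lemma kl_delta_char:
  assumes m: "Suc m = 2 ^ s"
  shows "2 ^ r * real (kl_delta m (\<beta> :: 'a)) = (2 ^ r - 1) ^ m - (-1) ^ m +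
    2 ^ r * (\<Sum>as\<in>unit_tuples m. canonical_char r (sum_list as) *
      (if prod_list (map inverse as) = \<beta> then 1 else 0))"
proof -
  \<comment> \<open>In characteristic 2 the difference of \<open>kl_arg as\<close> and \<beta> may
    be written as a sum.\<close>
  have "- y = y" for y :: 'a
    by (rule uminus_CHAR_2) (simp add: CHAR_eq_2[OF card_field])
  then have zero_iff [simp]: "x + y = 0 \<longleftrightarrow> x = y" for x y :: 'a
    by (auto simp: add_eq_0_iff)
  have "2 ^ r * real (kl_delta m \<beta>) =
      (\<Sum>as\<in>unit_tuples m. if kl_arg as + \<beta> = 0 then 2 ^ r else (0 :: real))"
    by (simp only: zero_iff) (simp add: kl_delta_def sum.If_cases Int_def)
  also have "\<dots> = (\<Sum>as\<in>unit_tuples m. \<Sum>a\<in>UNIV. canonical_char r (a * (kl_arg as + \<beta>)))"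
    by (simp only: canonical_char_orthogonality)
  also have "\<dots> = (\<Sum>a\<in>UNIV. canonical_char r (a * \<beta>) *
      (\<Sum>as\<in>unit_tuples m. canonical_char r (a * kl_arg as)))"
    by (subst sum.swap) (simp add: ring_distribs canonical_char_add sum_distrib_left mult.commute)
  \<comment> \<open>The trivial character is split off, because the evaluation by Kloosterman sums
    holds for nonzero \<open>a\<close> only.\<close>
  also have "\<dots> = real (card (unit_tuples m :: 'a list set)) +
      (\<Sum>a\<in>UNIV - {0}. canonical_char r (a * \<beta>) *
        (\<Sum>as\<in>unit_tuples m. canonical_char r (a * kl_arg as)))"
    by (subst sum.remove[of UNIV 0]) auto
  also have "(\<Sum>a\<in>UNIV - {0}. canonical_char r (a * \<beta>) *
        (\<Sum>as\<in>unit_tuples m. canonical_char r (a * kl_arg as))) =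
      (\<Sum>a\<in>UNIV - {0}. canonical_char r (a * \<beta>) * kloosterman (canonical_char r) m a)"
    using m by (intro sum.cong) (simp_all add: sum_canonical_char_kl_arg)
  also have "\<dots> = (\<Sum>as\<in>unit_tuples m. canonical_char r (sum_list as) *
      (\<Sum>a\<in>UNIV - {0}. canonical_char r (a * (prod_list (map inverse as) + \<beta>))))"
    unfolding kloosterman_def sum_distrib_left
    by (subst sum.swap) (simp add: ring_distribs canonical_char_add mult_ac)
  \<comment> \<open>The omitted \<open>a = 0\<close> leaves the -1, which sums to the term
    \<open>- (-1) ^ m\<close>.\<close>
  also have "\<dots> = (\<Sum>as\<in>unit_tuples m. canonical_char r (sum_list as) *
      (2 ^ r * (if prod_list (map inverse as) = \<beta> then 1 else 0) - 1))"
    by (intro sum.cong) (auto simp: canonical_char_orthogonality_nonzero)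
  also have "\<dots> = 2 ^ r * (\<Sum>as\<in>unit_tuples m. canonical_char r (sum_list as) *
      (if prod_list (map inverse as) = \<beta> then 1 else 0)) - (-1) ^ m"
    by (simp add: right_diff_distrib sum_subtractf sum_canonical_char_sum_list sum_distrib_left mult_ac)
  finally show ?thesis
    by (simp add: card_unit_tuples of_nat_diff)
qed

section \<open>Power moments\<close>

definition char_weight :: "'b set \<Rightarrow> ('b \<Rightarrow> 'a) \<Rightarrow> 'a \<Rightarrow> nat"
  where "char_weight U f a = card {x\<in>U. canonical_char r (a * f x) = -1}"

text \<open>Each product over \<open>T\<close> expands into characters at the sums of subsets
  \<open>J\<close> of \<open>T\<close>. Summation over \<open>a\<close> retains only the zero-sum
  \<open>J\<close>, and each of these is counted once for every \<open>T\<close> of size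
  \<open>t\<close> containing it.\<close>

lemma sum_binomial_char_weight:
  fixes f :: "'b \<Rightarrow> 'a"
  assumes U: "finite U"
  shows "(\<Sum>a\<in>UNIV. 2 ^ t * real (char_weight U f a choose t)) =
    2 ^ r * (\<Sum>j\<le>t. (-1) ^ j * real (card {T. T \<subseteq> U \<and> sum f T = 0 \<and> card T = j}) *
      real ((card U - j) choose (t - j)))"
proof -
  let ?S = "{T. T \<subseteq> U \<and> card T = t}"
  let ?Z = "{T. T \<subseteq> U \<and> sum f T = 0 \<and> card T \<le> t}"
  \<comment> \<open>The total contribution of \<open>J\<close> over all \<open>a\<close>; it does
    not depend on the set \<open>T\<close> in which \<open>J\<close> occurs.\<close>
  define G where "G J = (\<Sum>a\<in>UNIV. (-1) ^ card J * canonical_char r (a * sum f J))" for J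
  have G: "G J = (if sum f J = 0 then (-1) ^ card J * 2 ^ r else 0)" for J
    by (simp add: G_def canonical_char_orthogonality flip: sum_distrib_left)
  have prod: "(\<Prod>x\<in>T. 1 - canonical_char r (a * f x)) =
      (\<Sum>J | J \<in> Pow U \<and> J \<subseteq> T. (-1) ^ card J * canonical_char r (a * sum f J))"
    if "T \<subseteq> U" for a T
  proof -
    have "finite T" and Pow: "Pow T = {J. J \<in> Pow U \<and> J \<subseteq> T}"
      using that U finite_subset by auto
    then have "(\<Prod>x\<in>T. - canonical_char r (a * f x) + 1) =
        (\<Sum>J\<in>Pow T. \<Prod>x\<in>J. - canonical_char r (a * f x))"
      by (subst prod_add) simp_all
    also have "\<dots> = (\<Sum>J\<in>Pow T. (-1) ^ card J * canonical_char r (a * sum f J))"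
      by (simp add: prod_uminus canonical_char_sum sum_distrib_left)
    finally show ?thesis
      by (simp add: Pow)
  qed
  have "(\<Sum>a\<in>UNIV. 2 ^ t * real (char_weight U f a choose t)) =
      (\<Sum>a\<in>UNIV. \<Sum>T\<in>?S. \<Prod>x\<in>T. 1 - canonical_char r (a * f x))"
    unfolding char_weight_def
    by (subst binomial_weight_expansion[OF U canonical_char_cases]) simp
  also have "\<dots> = (\<Sum>T\<in>?S. \<Sum>J | J \<in> Pow U \<and> J \<subseteq> T. G J)"
    unfolding G_def by (subst sum.swap, subst (2) sum.swap) (simp add: prod)
  \<comment> \<open>With \<open>J\<close> outermost, only the number of supersets \<open>T\<close>
    of size \<open>t\<close> remains to be found.\<close>
  also have "\<dots> = (\<Sum>J\<in>Pow U. \<Sum>T | T \<in> ?S \<and> J \<subseteq> T. G J)"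
    by (rule sum.swap_restrict) (use U in auto)
  also have "\<dots> = (\<Sum>J\<in>Pow U. G J *
      real (if card J \<le> t then (card U - card J) choose (t - card J) else 0))"
  proof (rule sum.cong[OF refl])
    fix J assume "J \<in> Pow U"
    moreover have "{T. T \<in> ?S \<and> J \<subseteq> T} = {T. J \<subseteq> T \<and> T \<subseteq> U \<and> card T = t}"
      by auto
    ultimately show "(\<Sum>T | T \<in> ?S \<and> J \<subseteq> T. G J) =
        G J * real (if card J \<le> t then (card U - card J) choose (t - card J) else 0)"
      using U by (simp add: card_supersets)
  qed
  also have "\<dots> = (\<Sum>J\<in>?Z. 2 ^ r * ((-1) ^ card J * real ((card U - card J) choose (t - card J))))"
    using U by (intro sum.mono_neutral_cong_right) (auto simp: G)
  also have "\<dots> = 2 ^ r * (\<Sum>J\<in>?Z. (-1) ^ card J * real ((card U - card J) choose (t - card J)))"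
    by (simp add: sum_distrib_left)
  also have "(\<Sum>J\<in>?Z. (-1) ^ card J * real ((card U - card J) choose (t - card J))) =
      (\<Sum>j\<le>t. \<Sum>J | J \<in> ?Z \<and> card J = j. (-1) ^ card J * real ((card U - card J) choose (t - card J)))"
    using U by (intro sum.group[symmetric]) auto
  also have "\<dots> = (\<Sum>j\<le>t. \<Sum>J | J \<subseteq> U \<and> sum f J = 0 \<and> card J = j.
      (-1) ^ j * real ((card U - j) choose (t - j)))"
    by (intro sum.cong) auto
  finally show ?thesis
    by (simp add: mult_ac)
qed

text \<open>The Pless power moment identity. Summing over the field elements \<open>a\<close> instead of the words of
  the dual code makes the dimension of that code irrelevant.\<close>

lemma pless_power_moment:
  fixes f :: "'b \<Rightarrow> 'a"
  assumes U: "finite U"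
  shows "(\<Sum>a\<in>UNIV. (2 * real (char_weight U f a)) ^ h) =
    2 ^ r * (\<Sum>j=0..min (card U) h. (-1) ^ j *
      real (card {T. T \<subseteq> U \<and> sum f T = 0 \<and> card T = j}) *
      (\<Sum>t=j..h. fact t * real (Stirling h t) * 2 ^ (h - t) *
        real (binomial_int (card U - j) (int (card U) - int t))))"
proof -
  let ?C = "\<lambda>j. real (card {T. T \<subseteq> U \<and> sum f T = 0 \<and> card T = j})"
  let ?s = "\<lambda>t. fact t * real (Stirling h t) * 2 ^ (h - t)"
  have "(2 * real (char_weight U f a)) ^ h =
      (\<Sum>t\<le>h. ?s t * (2 ^ t * real (char_weight U f a choose t)))" for a
  proof -
    have "real (char_weight U f a) ^ h =
        (\<Sum>t\<le>h. fact t * real (Stirling h t) * real (char_weight U f a choose t))"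
      by (simp add: pow_eq_sum_Stirling[of _ h] flip: of_nat_power)
    then have "(2 * real (char_weight U f a)) ^ h =
        (\<Sum>t\<le>h. 2 ^ h * (fact t * real (Stirling h t) * real (char_weight U f a choose t)))"
      by (simp add: power_mult_distrib sum_distrib_left)
    also have "\<dots> = (\<Sum>t\<le>h. ?s t * (2 ^ t * real (char_weight U f a choose t)))"
    proof (rule sum.cong[OF refl])
      fix t assume "t \<in> {..h}"
      \<comment> \<open>The factor \<open>2 ^ t\<close> goes with the binomial coefficient, as
        \<open>sum_binomial_char_weight\<close> requires; \<open>2 ^ (h - t)\<close> stays in the
        final formula.\<close>
      then have "(2 :: real) ^ h = 2 ^ (h - t) * 2 ^ t"
        by (simp flip: power_add)
      then show "2 ^ h * (fact t * real (Stirling h t) * real (char_weight U f a choose t)) =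
          ?s t * (2 ^ t * real (char_weight U f a choose t))"
        by (simp only: mult_ac)
    qed
    finally show ?thesis .
  qed
  then have "(\<Sum>a\<in>UNIV. (2 * real (char_weight U f a)) ^ h) =
      (\<Sum>t\<le>h. ?s t * (\<Sum>a\<in>UNIV. 2 ^ t * real (char_weight U f a choose t)))"
    by (simp only: sum_distrib_left) (rule sum.swap)
  also have "\<dots> = (\<Sum>t\<le>h. \<Sum>j | j \<in> {..h} \<and> j \<le> t.
      2 ^ r * ((-1) ^ j * ?C j * (?s t * real ((card U - j) choose (t - j)))))"
  proof (rule sum.cong[OF refl])
    fix t assume "t \<in> {..h}"
    \<comment> \<open>A common range for \<open>j\<close> with the restriction
      \<open>j \<le> t\<close> prepares the interchange of the triangular double sum.\<close>
    then have "{j. j \<in> {..h} \<and> j \<le> t} = {..t}"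
      by auto
    then show "?s t * (\<Sum>a\<in>UNIV. 2 ^ t * real (char_weight U f a choose t)) =
        (\<Sum>j | j \<in> {..h} \<and> j \<le> t.
          2 ^ r * ((-1) ^ j * ?C j * (?s t * real ((card U - j) choose (t - j)))))"
      by (simp only: sum_binomial_char_weight[OF U] sum_distrib_left mult_ac)
  qed
  also have "\<dots> = (\<Sum>j\<le>h. \<Sum>t | t \<in> {..h} \<and> j \<le> t.
      2 ^ r * ((-1) ^ j * ?C j * (?s t * real ((card U - j) choose (t - j)))))"
    by (rule sum.swap_restrict) auto
  also have "\<dots> = (\<Sum>j=0..min (card U) h. \<Sum>t=j..h.
      2 ^ r * ((-1) ^ j * ?C j * (?s t * real (binomial_int (card U - j) (int (card U) - int t)))))"
  proof (rule sum.mono_neutral_cong_right)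
    show "\<forall>j\<in>{..h} - {0..min (card U) h}. (\<Sum>t | t \<in> {..h} \<and> j \<le> t.
        2 ^ r * ((-1) ^ j * ?C j * (?s t * real ((card U - j) choose (t - j))))) = 0"
    proof
      \<comment> \<open>Such \<open>j\<close> exceed \<open>card U\<close>, and no subset of
        \<open>U\<close> is that large; hence the cap at \<open>min (card U) h\<close>.\<close>
      fix j assume j: "j \<in> {..h} - {0..min (card U) h}"
      then have "card T \<noteq> j" if "T \<subseteq> U" for T
        using card_mono[OF U that] by auto
      then have "{T. T \<subseteq> U \<and> sum f T = 0 \<and> card T = j} = {}"
        by blast
      then show "(\<Sum>t | t \<in> {..h} \<and> j \<le> t.
          2 ^ r * ((-1) ^ j * ?C j * (?s t * real ((card U - j) choose (t - j))))) = 0"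
        by (simp only: card.empty) simp
    qed
  next
    fix j assume j: "j \<in> {0..min (card U) h}"
    \<comment> \<open>For \<open>t \<le> card U\<close> this is the symmetry of binomial
      coefficients. For larger \<open>t\<close> both sides vanish: on the left the lower index is
      negative, on the right it exceeds the upper one because \<open>j \<le> card U\<close>.\<close>
    have "binomial_int (card U - j) (int (card U) - int t) = (card U - j) choose (t - j)"
      if "j \<le> t" for t
    proof (cases "t \<le> card U")
      case True
      then have "nat (int (card U) - int t) = card U - j - (t - j)"
        using that by auto
      then show ?thesis
        using True that binomial_symmetric[of "t - j" "card U - j"]
        by (simp add: binomial_int_def)
    next
      case False
      moreover have "card U - j < t - j"
        using False that j by (simp add: diff_less_mono)
      ultimately show ?thesis
        by (simp add: binomial_int_def binomial_eq_0)
    qed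
    then show "(\<Sum>t | t \<in> {..h} \<and> j \<le> t.
        2 ^ r * ((-1) ^ j * ?C j * (?s t * real ((card U - j) choose (t - j))))) =
        (\<Sum>t=j..h. 2 ^ r * ((-1) ^ j * ?C j *
          (?s t * real (binomial_int (card U - j) (int (card U) - int t)))))"
      by (intro sum.cong) auto
  qed auto
  finally show ?thesis
    by (simp only: sum_distrib_left)
qed

text \<open>Each character value is 1 or -1, and every -1 lowers the sum by 2 from the number of
  tuples.\<close>

lemma kloosterman_char_weight:
  assumes "a \<noteq> 0" "Suc m = 2 ^ s"
  shows "kloosterman (canonical_char r) m a =
    real ((2 ^ r - 1) ^ m) - 2 * real (char_weight (unit_tuples m) kl_arg a)"
proof -
  have "kloosterman (canonical_char r) m a =
      (\<Sum>as\<in>unit_tuples m. 1 - 2 * (if canonical_char r (a * kl_arg as) = -1 then 1 else 0))"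
    unfolding sum_canonical_char_kl_arg[OF assms, symmetric]
    using canonical_char_cases by (intro sum.cong) auto
  also have "\<dots> = real (card (unit_tuples m :: 'a list set)) -
      2 * real (char_weight (unit_tuples m) kl_arg a)"
    unfolding sum_subtractf sum_distrib_left[symmetric] char_weight_def
    by (simp flip: sum.inter_filter)
  finally show ?thesis
    by (simp add: card_unit_tuples)
qed

text \<open>For nonzero \<open>a\<close>, twice the weight is \<open>N\<close> minus the Kloosterman
  sum. Expanding its power \<open>h\<close> and solving for the top term \<open>l = h\<close>
  isolates the moment of order \<open>h\<close>.\<close>

lemma kloosterman_moment_recursion:
  assumes "h \<ge> 1" "Suc m = 2 ^ s"
  shows "kloosterman_moment (canonical_char r :: 'a \<Rightarrow> real) m h =
    (\<Sum>l=0..h-1. (-1) ^ (h + l + 1) * real (h choose l) * real ((2 ^ r - 1) ^ m) ^ (h - l) *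
      kloosterman_moment (canonical_char r :: 'a \<Rightarrow> real) m l) +
    (-1) ^ h * (\<Sum>a\<in>UNIV. (2 * real (char_weight (unit_tuples m) kl_arg a)) ^ h)"
proof -
  obtain k where h: "h = Suc k"
    using assms(1) by (cases h) auto
  let ?M = "kloosterman_moment (canonical_char r :: 'a \<Rightarrow> real) m"
  let ?K = "kloosterman (canonical_char r :: 'a \<Rightarrow> real) m"
  define N where "N = real ((2 ^ r - 1) ^ m)"
  \<comment> \<open>The element 0 has weight 0 and contributes nothing because
    \<open>h \<ge> 1\<close>, so the sum over the units may be taken over the whole field.\<close>
  have "char_weight (unit_tuples m) kl_arg 0 = 0"
    by (simp add: char_weight_def)
  then have "(\<Sum>a\<in>UNIV. (2 * real (char_weight (unit_tuples m) kl_arg a)) ^ h) =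
      (\<Sum>a\<in>UNIV - {0}. (2 * real (char_weight (unit_tuples m) kl_arg a)) ^ h)"
    by (intro sum.mono_neutral_right) (auto simp: h)
  also have "\<dots> = (\<Sum>a\<in>UNIV - {0}. (- ?K a + N) ^ h)"
    using assms(2) by (intro sum.cong) (auto simp: kloosterman_char_weight N_def)
  also have "\<dots> = (\<Sum>l\<le>h. \<Sum>a\<in>UNIV - {0}. real (h choose l) * (- ?K a) ^ l * N ^ (h - l))"
    by (subst binomial_ring) (rule sum.swap)
  also have "\<dots> = (\<Sum>l\<le>h. (-1) ^ l * real (h choose l) * N ^ (h - l) * ?M l)"
    unfolding kloosterman_moment_def sum_distrib_left
    by (intro sum.cong refl) (simp add: power_minus[of "?K _"])
  also have "\<dots> = (\<Sum>l=0..k. (-1) ^ l * real (h choose l) * N ^ (h - l) * ?M l) + (-1) ^ h * ?M h"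
    by (simp add: h atMost_atLeast0)
  finally have "(-1) ^ h * (\<Sum>a\<in>UNIV. (2 * real (char_weight (unit_tuples m) kl_arg a)) ^ h) =
      (-1) ^ h * (\<Sum>l=0..k. (-1) ^ l * real (h choose l) * N ^ (h - l) * ?M l) +
      ((-1) ^ h * (-1) ^ h) * ?M h"
    by (simp only: distrib_left mult.assoc)
  moreover have "(-1) ^ h * (-1) ^ h = (1 :: real)"
    by (simp flip: power_mult_distrib)
  moreover have "(\<Sum>l=0..h-1. (-1) ^ (h + l + 1) * real (h choose l) * N ^ (h - l) * ?M l) =
      - ((-1) ^ h * (\<Sum>l=0..k. (-1) ^ l * real (h choose l) * N ^ (h - l) * ?M l))"
    unfolding sum_distrib_left sum_negf[symmetric]
    by (rule sum.cong) (simp_all add: h power_add)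
  ultimately show ?thesis
    unfolding N_def[symmetric] by (simp only:)
qed

end

section \<open>Assembly of the recursion, the weight distribution and the values of
  \<open>kl_delta\<close>\<close>

theorem theorem1:
  fixes r s n q N :: nat
    and \<psi> :: "'a::finite_field \<Rightarrow> real"
    and tuples :: "'a list list"
    and C :: "bit list set"
  assumes "r \<ge> 3" and "q = 2 ^ r" and "CARD('a) = q"
    and "s > 0" and "n = 2 ^ s"
    and "N = (q - 1) ^ (n - 1)"
    and "\<psi> = canonical_char r"
    and "distinct tuples" and "set tuples = unit_tuples (n - 1)"
    and "C = binary_code (map kl_arg tuples)"
  shows
    "(\<forall>h\<ge>1. kloosterman_moment \<psi> (n - 1) h =
        (\<Sum>l=0..h-1. (-1) ^ (h + l + 1) * real (h choose l) *
            real (q - 1) ^ ((n - 1) * (h - l)) * kloosterman_moment \<psi> (n - 1) l)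
        + real q * (\<Sum>j=0..min N h. (-1) ^ (h + j) * real (weight_count C j) *
            (\<Sum>t=j..h. fact t * real (Stirling h t) * 2 ^ (h - t) *
               real (binomial_int (N - j) (int N - int t))))) \<and>
     (\<forall>j. weight_count C j =
        (\<Sum>\<nu> | (\<forall>\<beta>::'a. \<nu> \<beta> \<le> kl_delta (n - 1) \<beta>) \<and>
               (\<Sum>\<beta>\<in>UNIV. \<nu> \<beta>) = j \<and> (\<Sum>\<beta>\<in>UNIV. of_nat (\<nu> \<beta>) * \<beta>) = 0.
           \<Prod>\<beta>\<in>UNIV. kl_delta (n - 1) \<beta> choose \<nu> \<beta>)) \<and>
     real (kl_delta (n - 1) (0::'a)) = 1 / real q * (real (q - 1) ^ (n - 1) + 1) \<and>
     (\<forall>\<beta>::'a. \<beta> \<noteq> 0 \<longrightarrow> real (kl_delta (n - 1) \<beta>) =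
        kloosterman \<psi> (n - 2) (inverse \<beta>) + 1 / real q * (real (q - 1) ^ (n - 1) + 1))"
proof -
  let ?U = "unit_tuples (n - 1) :: 'a list set"
  note card_field = assms(3)[unfolded assms(2)]
  have n: "Suc (n - 1) = 2 ^ s"
    by (simp add: assms(5))
  have "even n" "n > 0"
    using assms(4,5) by simp_all
  \<comment> \<open>The first fact leaves a coordinate to be split off; oddness turns
    \<open>- (-1) ^ (n - 1)\<close> into the \<open>+ 1\<close> of the formula for
    \<open>kl_delta\<close>.\<close>
  then have n2: "n - 1 = Suc (n - 2)" and odd: "odd (n - 1)"
    by (auto elim!: evenE)
  have U: "finite ?U" "card ?U = N"
    by (simp_all add: card_unit_tuples[OF card_field] assms(2,6))
  have count: "weight_count C j = card {T. T \<subseteq> ?U \<and> sum kl_arg T = 0 \<and> card T = j}" for j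
    using weight_count_binary_code[OF assms(8), of kl_arg j] by (simp add: assms(9,10))
  have moments: "kloosterman_moment \<psi> (n - 1) h =
      (\<Sum>l=0..h-1. (-1) ^ (h + l + 1) * real (h choose l) *
          real (q - 1) ^ ((n - 1) * (h - l)) * kloosterman_moment \<psi> (n - 1) l)
      + real q * (\<Sum>j=0..min N h. (-1) ^ (h + j) * real (weight_count C j) *
          (\<Sum>t=j..h. fact t * real (Stirling h t) * 2 ^ (h - t) *
             real (binomial_int (N - j) (int N - int t))))" if "h \<ge> 1" for h
    using kloosterman_moment_recursion[OF card_field that n]
    unfolding pless_power_moment[OF card_field U(1)] count U(2) of_nat_power power_mult[symmetric]
    by (simp add: assms(2,7) power_add sum_distrib_left mult_ac)
  have weights: "weight_count C j =
      (\<Sum>\<nu> | (\<forall>\<beta>::'a. \<nu> \<beta> \<le> kl_delta (n - 1) \<beta>) \<and>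
             (\<Sum>\<beta>\<in>UNIV. \<nu> \<beta>) = j \<and> (\<Sum>\<beta>\<in>UNIV. of_nat (\<nu> \<beta>) * \<beta>) = 0.
         \<Prod>\<beta>\<in>UNIV. kl_delta (n - 1) \<beta> choose \<nu> \<beta>)" for j
    unfolding count kl_delta_def by (rule card_zero_sum_subsets[OF U(1)])
  have delta: "real (kl_delta (n - 1) \<beta>) = 1 / real q * (real (q - 1) ^ (n - 1) + 1) +
      (\<Sum>as\<in>?U. \<psi> (sum_list as) * (if prod_list (map inverse as) = \<beta> then 1 else 0))" for \<beta> :: 'a
    using kl_delta_char[OF card_field n, of \<beta>] odd
    by (simp add: assms(2,7) of_nat_diff field_simps)
  \<comment> \<open>A product of inverses of units is never 0, so the value at 0 has no Kloosterman
    term.\<close>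
  have "(\<Sum>as\<in>?U. \<psi> (sum_list as) * (if prod_list (map inverse as) = 0 then 1 else 0)) = 0"
    using prod_list_unit_tuples
    by (intro sum.neutral) (auto simp: prod_list_map_inverse)
  moreover have "(\<Sum>as\<in>?U. \<psi> (sum_list as) * (if prod_list (map inverse as) = \<beta> then 1 else 0)) =
      kloosterman \<psi> (n - 2) (inverse \<beta>)" if "\<beta> \<noteq> 0" for \<beta>
    unfolding n2 assms(7) using sum_canonical_char_fixed_product[OF card_field that] by simp
  ultimately show ?thesis
    using moments weights delta by (simp add: add.commute)
qed

end
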